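(* Let $f:\mathbb{R}^d\to\mathbb{R}$ be differentiable with $L_{\nabla f}$-Lipschitz continuous gradient, let $h:\mathbb{R}^d\to(-\infty,+\infty]$ be proper, lower semicontinuous and convex, and suppose $F:=f+h$ is bounded below by $F_{\mathrm{low}}\in\mathbb{R}$. Consider the sequences generated by the nonsmooth trust-region method described in the context, and suppose that: (a) there exist $\mu>0$ and $t\in[0,1]$ such that $\max_{j\in\{0,\dots,k\}}\|H_j\|\le \mu(1+k^t)$ for all $k\in\mathbb{N}$; (b) there exist $\kappa_p>0$ and $\gamma_{\max}>0$ (independent of $k$) such that for all $k\in\mathbb{N}$ $$m_k(0)-m_k(p_k)\ \ge\ \kappa_p\,\pi_k(\gamma_{\max})\min\left\{\Delta_k,\ \frac{\pi_k(\gamma_{\max})}{1+\|H_k\|}\right\}.$$ Then, as $\epsilon\to0^+$: if $0\le t<1$, then $k_\epsilon=O(\epsilon^{-2/(1-t)})$; and if $t=1$, then $k_\epsilon=\tilde O(e^{c\epsilon^{-2}})$ for some $c>0$, where $\tilde O(\cdot)$ hides logarithmic factors of size $\log(1/\epsilon)$.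
   Context: $\|\cdot\|$ is the Euclidean norm on $\mathbb{R}^d$ and the matrix 2-norm; $\mathbb{N}=\{0,1,2,\dots\}$; $0^0=1$. For $\gamma>0$, $\mathrm{Prox}_{\gamma h}(x):=\operatorname{argmin}_{z\in\mathbb{R}^d}\left(h(z)+\frac{1}{2\gamma}\|z-x\|^2\right)$, and the stationarity measure is $\pi(x,\gamma):=\frac1\gamma\|\mathrm{Prox}_{\gamma h}(x-\gamma\nabla f(x))-x\|$, with $\pi_k(\gamma):=\pi(x_k,\gamma)$. Nonsmooth trust-region method: given $x_0\in\operatorname{dom}F$, $\Delta_0>0$, scaling factors $0<\gamma_{\mathrm{dec}}<1<\gamma_{\mathrm{inc}}$ and $\eta\in(0,1)$, for $k=0,1,2,\dots$: choose a symmetric $H_k\in\mathbb{R}^{d\times d}$ and form the model $m_k(p):=f(x_k)+\nabla f(x_k)^\top p+\frac12 p^\top H_k p+h(x_k+p)$; choose a step $p_k\in\mathbb{R}^d$ with $\|p_k\|\le\Delta_k$ (an approximate minimizer of $m_k$ over $\|p\|\le\Delta_k$); compute $\rho_k:=\frac{F(x_k)-F(x_k+p_k)}{m_k(0)-m_k(p_k)}$; if $\rho_k\ge\eta$ (successful iteration) set $x_{k+1}=x_k+p_k$, $\Delta_{k+1}=\gamma_{\mathrm{inc}}\Delta_k$; otherwise (unsuccessful iteration) set $x_{k+1}=x_k$, $\Delta_{k+1}=\gamma_{\mathrm{dec}}\Delta_k$. $k_\epsilon$ is the first iteration index $k$ with $\pi_k(\gamma_{\max})<\epsilon$ ($k_\epsilon=\infty$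 if there is none). *)

theory Defs
  imports "HOL-Analysis.Analysis" "HOL-Library.Landau_Symbols"
begin

definition proper :: "('a \<Rightarrow> ereal) \<Rightarrow> bool" where
  "proper h \<longleftrightarrow> (\<forall>x. h x \<noteq> -\<infinity>) \<and> (\<exists>x. h x \<noteq> \<infinity>)"

definition effective_domain :: "('a \<Rightarrow> ereal) \<Rightarrow> 'a set" where
  "effective_domain h = {x. h x < \<infinity>}"

definition lower_semicontinuous :: "('a::topological_space \<Rightarrow> ereal) \<Rightarrow> bool" where
  "lower_semicontinuous h \<longleftrightarrow> (\<forall>x. h x \<le> Liminf (at x) h)"

definition convex_ereal :: "('a::real_vector \<Rightarrow> ereal) \<Rightarrow> bool" where
  "convex_ereal h \<longleftrightarrow> (\<forall>x y. \<forall>u\<in>{0<..<1}.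
     h ((1 - u) *\<^sub>R x + u *\<^sub>R y) \<le> ereal (1 - u) * h x + ereal u * h y)"

definition grad :: "('a::real_inner \<Rightarrow> real) \<Rightarrow> 'a \<Rightarrow> 'a" where
  "grad f x = (THE D. GDERIV f x :> D)"

definition objective :: "('a \<Rightarrow> real) \<Rightarrow> ('a \<Rightarrow> ereal) \<Rightarrow> 'a \<Rightarrow> ereal" where
  "objective f h x = ereal (f x) + h x"

definition Prox :: "real \<Rightarrow> ('a::real_normed_vector \<Rightarrow> ereal) \<Rightarrow> 'a \<Rightarrow> 'a" where
  "Prox \<gamma> h x = arg_min (\<lambda>z. h z + ereal (1 / (2 * \<gamma>) * (norm (z - x))\<^sup>2)) (\<lambda>z. True)"

definition stationarity ::
    "('a::real_inner \<Rightarrow> real) \<Rightarrow> ('a \<Rightarrow> ereal) \<Rightarrow> 'a \<Rightarrow> real \<Rightarrow> real" where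
  "stationarity f h x \<gamma> = 1 / \<gamma> * norm (Prox \<gamma> h (x - \<gamma> *\<^sub>R grad f x) - x)"

text \<open>The matrix 2-norm is the operator norm; the type-class \<open>norm\<close> on matrices is the
  Frobenius norm.\<close>

definition norm2 :: "real^'n^'m \<Rightarrow> real" where
  "norm2 A = onorm (\<lambda>v. A *v v)"

definition model ::
    "(real^'d \<Rightarrow> real) \<Rightarrow> (real^'d \<Rightarrow> ereal) \<Rightarrow> real^'d \<Rightarrow> real^'d^'d \<Rightarrow> real^'d \<Rightarrow> ereal" where
  "model f h x H p = ereal (f x + grad f x \<bullet> p + 1 / 2 * (p \<bullet> (H *v p))) + h (x + p)"

text \<open>When the model decrease vanishes, the ratio is undefined in the mathematics and takes
  the value \<open>(F(x) - F(x+p)) * \<infinity>\<close> here (with \<open>0 * \<infinity> = 0\<close>). Under the sufficient decrease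
  assumption this happens only at an iterate with zero stationarity measure.\<close>

definition ratio ::
    "(real^'d \<Rightarrow> real) \<Rightarrow> (real^'d \<Rightarrow> ereal) \<Rightarrow> real^'d \<Rightarrow> real^'d^'d \<Rightarrow> real^'d \<Rightarrow> ereal" where
  "ratio f h x H p =
     (objective f h x - objective f h (x + p)) / (model f h x H 0 - model f h x H p)"

text \<open>The requirement that \<open>p k\<close> approximately minimises
  the model is not part of this predicate: its quantitative form is the sufficient decrease
  condition, which is a separate hypothesis.\<close>

definition trust_region_run ::
    "(real^'d \<Rightarrow> real) \<Rightarrow> (real^'d \<Rightarrow> ereal) \<Rightarrow> real \<Rightarrow> real \<Rightarrow> real \<Rightarrow>
     (nat \<Rightarrow> real^'d) \<Rightarrow> (nat \<Rightarrow> real) \<Rightarrow> (nat \<Rightarrow> real^'d^'d) \<Rightarrow> (nat \<Rightarrow> real^'d) \<Rightarrow> bool" where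
  "trust_region_run f h \<gamma>dec \<gamma>inc \<eta> x \<Delta> H p \<longleftrightarrow>
     x 0 \<in> effective_domain (objective f h) \<and> \<Delta> 0 > 0 \<and>
     (\<forall>k. transpose (H k) = H k \<and> norm (p k) \<le> \<Delta> k \<and>
       (if ratio f h (x k) (H k) (p k) \<ge> ereal \<eta>
        then x (Suc k) = x k + p k \<and> \<Delta> (Suc k) = \<gamma>inc * \<Delta> k
        else x (Suc k) = x k \<and> \<Delta> (Suc k) = \<gamma>dec * \<Delta> k))"

definition first_index ::
    "('a::real_inner \<Rightarrow> real) \<Rightarrow> ('a \<Rightarrow> ereal) \<Rightarrow> (nat \<Rightarrow> 'a) \<Rightarrow> real \<Rightarrow> real \<Rightarrow> enat" where
  "first_index f h x \<gamma> \<epsilon> =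
     (if \<exists>k. stationarity f h (x k) \<gamma> < \<epsilon>
      then enat (LEAST k. stationarity f h (x k) \<gamma> < \<epsilon>) else \<infinity>)"

text \<open>Powers \<open>k\<^sup>t\<close> with the convention \<open>0\<^sup>0 = 1\<close>, whereas \<open>0 powr 0 = 0\<close> in the library.\<close>

definition nat_rpow :: "nat \<Rightarrow> real \<Rightarrow> real" where
  "nat_rpow k t = (if t = 0 then 1 else real k powr t)"

text \<open>\<open>K(\<epsilon>) = O(g(\<epsilon>))\<close> as \<open>\<epsilon> \<rightarrow> 0+\<close> for extended naturals \<open>K(\<epsilon>)\<close>; the bound includes that
  \<open>K(\<epsilon>)\<close> is finite for small \<open>\<epsilon>\<close>.\<close>

definition enat_bigo :: "(real \<Rightarrow> enat) \<Rightarrow> (real \<Rightarrow> real) \<Rightarrow> bool" where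
  "enat_bigo K g \<longleftrightarrow> (\<forall>\<^sub>F \<epsilon> in at_right 0. K \<epsilon> \<noteq> \<infinity>) \<and>
     (\<lambda>\<epsilon>. real (the_enat (K \<epsilon>))) \<in> O[at_right 0](g)"

definition enat_soft_bigo :: "(real \<Rightarrow> enat) \<Rightarrow> (real \<Rightarrow> real) \<Rightarrow> bool" where
  "enat_soft_bigo K g \<longleftrightarrow> (\<exists>q::nat. enat_bigo K (\<lambda>\<epsilon>. g \<epsilon> * ln (1 / \<epsilon>) ^ q))"

end

theory Submission
  imports Defs
begin

text \<open>Before iteration \<open>k\<^sub>\<epsilon>\<close> the stationarity measure is at least \<open>\<epsilon>\<close>, so a step can only fail when
  the radius exceeds a multiple of \<open>\<epsilon> / M k\<close>, where \<open>M k\<close> bounds the model Hessians. Hence the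
  radius stays above such a multiple, failures are controlled by successes up to logarithmic terms,
  and a success decreases the objective by a multiple of \<open>\<epsilon>\<^sup>2 / M k\<close>. If \<open>M k\<close> grows like \<open>k\<^sup>t\<close>
  with \<open>t < 1\<close>, bounding every \<open>M k\<close> by the last one already gives the rate. If \<open>M k\<close> grows
  linearly, the decrease at the \<open>n\<close>-th success is at least a multiple of
  \<open>\<epsilon>\<^sup>2 / (n + 2 + ln (1 / \<epsilon>))\<close>, and the harmonic sum makes \<open>n\<close> at most exponential in
  \<open>\<epsilon>\<close> to the power \<open>-2\<close>.\<close>

section \<open>The scalar recursion for radius and objective\<close>

lemma ln_1_plus_le_linear:
  assumes "r > 0" "x \<ge> (0::real)"
  shows "ln (1 + x) \<le> r * x + (r - 1 - ln r)"
proof -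
  \<comment> \<open>This is the tangent of the logarithm at 1, taken at a rescaled argument. The
    slope \<open>r\<close> stays free, so logarithmic growth can later be absorbed into an
    arbitrarily small linear term.\<close>
  have "ln (r * (1 + x)) \<le> r * (1 + x) - 1"
    using assms by (intro ln_le_minus_one) simp
  moreover have "ln (r * (1 + x)) = ln r + ln (1 + x)"
    using assms by (simp add: ln_mult)
  ultimately show ?thesis
    by (simp add: algebra_simps)
qed

text \<open>Only real sequences remain here: \<open>\<phi>\<close> holds the objective values,
  \<open>\<sigma>\<close> the stationarity measures, \<open>M\<close> bounds one plus the Hessian
  norms, and \<open>s\<close> marks successes. The rules \<open>success\<close> and
  \<open>failure\<close> require \<open>\<sigma> k > 0\<close> because otherwise the model decrease
  may vanish and the ratio test carries no information.\<close>

locale radius_descent =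
  fixes \<phi> \<Delta> \<sigma> M :: "nat \<Rightarrow> real" and s :: "nat \<Rightarrow> bool"
    and low \<gamma>d \<gamma>i a \<nu> m :: real
  assumes low: "low \<le> \<phi> k"
    and success: "s k \<Longrightarrow> \<sigma> k > 0 \<Longrightarrow> \<phi> (Suc k) \<le> \<phi> k - a * (\<sigma> k * min (\<Delta> k) (\<sigma> k / M k))"
    and failure: "\<not> s k \<Longrightarrow> \<sigma> k > 0 \<Longrightarrow> \<nu> * (\<sigma> k * min (\<Delta> k) (\<sigma> k / M k)) \<le> M k * (\<Delta> k)\<^sup>2"
    and stay: "\<not> s k \<Longrightarrow> \<phi> (Suc k) = \<phi> k"
    and radius_0: "\<Delta> 0 > 0"
    and radius_Suc: "\<Delta> (Suc k) = (if s k then \<gamma>i else \<gamma>d) * \<Delta> k"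
    and factors: "0 < \<gamma>d" "\<gamma>d < 1" "1 < \<gamma>i" and a_pos: "a > 0" and \<nu>_pos: "\<nu> > 0"
    and M_mono: "mono M" and M_ge_1: "M k \<ge> 1" and M_le: "M k \<le> m * (1 + real k)"
begin

definition N :: "nat \<Rightarrow> nat" where "N k = card {j. j < k \<and> s j}"

text \<open>The two arguments are the two ways in which the radius can become small: it starts
  small, or a failure at the smallest radius that permits one shrinks it by
  \<open>\<gamma>d\<close>.\<close>

definition \<delta> :: real where "\<delta> = min (\<Delta> 0) (\<gamma>d * min 1 \<nu>)"

lemma N_0 [simp]: "N 0 = 0"
  by (simp add: N_def)

lemma N_Suc: "N (Suc k) = N k + (if s k then 1 else 0)"
proof -
  have "{j. j < Suc k \<and> s j} = (if s k then insert k {j. j < k \<and> s j} else {j. j < k \<and> s j})"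
    by (auto simp: less_Suc_eq)
  then show ?thesis
    by (simp add: N_def)
qed

lemma \<delta>_pos: "\<delta> > 0"
  using radius_0 factors \<nu>_pos by (simp add: \<delta>_def)

lemma m_pos: "m > 0"
  using M_le[of 0] M_ge_1[of 0] by simp

lemma M_pos: "M k > 0"
  using M_ge_1[of k] by linarith

lemma radius_pos: "\<Delta> k > 0"
  using radius_0 factors by (induction k) (simp_all add: radius_Suc)

lemma ln_radius: "ln (\<Delta> k) = ln (\<Delta> 0) + N k * ln \<gamma>i - (real k - N k) * ln (1 / \<gamma>d)"
proof (induction k)
  case (Suc k)
  then show ?case
    using radius_pos[of k] factors
    by (auto simp: radius_Suc N_Suc ln_mult ln_div algebra_simps)
qed simp

lemma radius_lower_failure:
  assumes "\<not> s k" "\<sigma> k \<ge> \<epsilon>" "\<epsilon> > 0"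
  shows "min 1 \<nu> * \<epsilon> / M k \<le> \<Delta> k"
proof (cases "\<Delta> k \<ge> \<sigma> k / M k")
  case True
  have "min 1 \<nu> * \<epsilon> \<le> 1 * \<sigma> k"
    using assms \<nu>_pos by (intro mult_mono) auto
  then have "min 1 \<nu> * \<epsilon> / M k \<le> \<sigma> k / M k"
    using M_pos[of k] by (simp add: divide_right_mono)
  with True show ?thesis by linarith
next
  case False
  \<comment> \<open>The minimum in \<open>failure\<close> is now the radius itself, so one factor
    \<open>\<Delta> k\<close> cancels.\<close>
  then have "(\<nu> * \<sigma> k) * \<Delta> k \<le> (M k * \<Delta> k) * \<Delta> k"
    using failure[of k] assms by (simp add: power2_eq_square min_def mult_ac)
  then have "\<nu> * \<sigma> k \<le> M k * \<Delta> k"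
    using radius_pos[of k] by simp
  moreover have "min 1 \<nu> * \<epsilon> \<le> \<nu> * \<sigma> k"
    using assms \<nu>_pos by (intro mult_mono) auto
  ultimately show ?thesis
    using M_pos[of k] by (simp add: field_simps)
qed

text \<open>Successes enlarge the radius. A failure needs a radius of at least
  \<open>min 1 \<nu> * \<epsilon> / M k\<close>, and the factor \<open>\<gamma>d\<close> it then
  costs is built into \<open>\<delta>\<close>. Monotonicity of \<open>M\<close> only weakens the
  bound at the next index. The radius at \<open>K\<close> depends only on earlier iterations, hence
  \<open>k \<le> K\<close>.\<close>

lemma radius_lower:
  assumes "0 < \<epsilon>" "\<epsilon> \<le> 1" "\<forall>j<K. \<epsilon> \<le> \<sigma> j" "k \<le> K"
  shows "\<delta> * \<epsilon> / M k \<le> \<Delta> k"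
  using assms(4)
proof (induction k)
  case 0
  have "\<delta> * \<epsilon> \<le> \<Delta> 0 * M 0"
    using assms M_ge_1[of 0] radius_0 \<delta>_pos
    by (intro mult_mono) (auto simp: \<delta>_def)
  then show ?case
    using M_pos[of 0] by (simp add: field_simps)
next
  case (Suc k)
  have "M k \<le> M (Suc k)"
    using M_mono by (simp add: mono_def)
  then have "\<delta> * \<epsilon> / M (Suc k) \<le> \<delta> * \<epsilon> / M k"
    using M_pos[of k] \<delta>_pos assms by (intro divide_left_mono) auto
  also have "\<dots> \<le> \<Delta> (Suc k)"
  proof (cases "s k")
    case True
    have "1 * \<Delta> k \<le> \<gamma>i * \<Delta> k"
      using radius_pos[of k] factors by (intro mult_right_mono) auto
    then show ?thesis
      using Suc True by (simp add: radius_Suc)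
  next
    case False
    have "\<delta> * \<epsilon> / M k \<le> (\<gamma>d * min 1 \<nu>) * \<epsilon> / M k"
      unfolding \<delta>_def using M_pos[of k] assms
      by (intro divide_right_mono mult_right_mono min.cobounded2) auto
    also have "\<dots> = \<gamma>d * (min 1 \<nu> * \<epsilon> / M k)"
      by simp
    also have "\<dots> \<le> \<gamma>d * \<Delta> k"
      using radius_lower_failure[of k \<epsilon>] False Suc assms factors by (intro mult_left_mono) auto
    finally show ?thesis
      using False by (simp add: radius_Suc)
  qed
  finally show ?case .
qed

text \<open>With \<open>\<delta>\<close> capped at 1, both arguments of the minimum in
  \<open>success\<close> are at least \<open>min \<delta> 1 * \<epsilon> / M k\<close>. The second
  factor \<epsilon> comes from \<open>\<sigma> k\<close>.\<close>

lemma descent: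
  assumes "0 < \<epsilon>" "\<epsilon> \<le> 1" "\<forall>j<K. \<epsilon> \<le> \<sigma> j" "k < K" "s k"
  shows "\<phi> (Suc k) \<le> \<phi> k - a * min \<delta> 1 * \<epsilon>\<^sup>2 / M k"
proof -
  have "min \<delta> 1 * \<epsilon> / M k \<le> \<delta> * \<epsilon> / M k"
    using assms M_pos[of k] by (intro divide_right_mono mult_right_mono) auto
  then have 1: "min \<delta> 1 * \<epsilon> / M k \<le> \<Delta> k"
    using radius_lower[of \<epsilon> K k] assms by auto
  have "min \<delta> 1 * \<epsilon> \<le> 1 * \<sigma> k"
    using assms by (intro mult_mono) auto
  then have "min \<delta> 1 * \<epsilon> / M k \<le> \<sigma> k / M k"
    using M_pos[of k] by (simp add: divide_right_mono)
  with 1 have "\<epsilon> * (min \<delta> 1 * \<epsilon> / M k) \<le> \<sigma> k * min (\<Delta> k) (\<sigma> k / M k)"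
    using assms \<delta>_pos M_pos[of k] by (intro mult_mono) auto
  then have "a * (\<epsilon> * (min \<delta> 1 * \<epsilon> / M k)) \<le> a * (\<sigma> k * min (\<Delta> k) (\<sigma> k / M k))"
    by (rule mult_left_mono) (use a_pos in simp)
  moreover have "\<sigma> k > 0"
    using assms by (meson less_le_trans)
  ultimately show ?thesis
    using success[of k] assms by (simp add: power2_eq_square mult_ac)
qed

text \<open>The radius is multiplied by at most a power of \<open>\<gamma>i\<close> per success but stays above
  \<open>\<delta> \<epsilon> / M k\<close>, so failures outnumber successes at most by a constant factor, up to
  \<open>ln (M k / \<epsilon>)\<close>.\<close>

lemma index_le_successes:
  obtains A where "A \<ge> 1"
    "\<And>\<epsilon> K k. \<lbrakk>0 < \<epsilon>; \<epsilon> \<le> 1; \<forall>j<K. \<epsilon> \<le> \<sigma> j; k \<le> K\<rbrakk> \<Longrightarrow> real k \<le> A * (N k + 1 + ln (1 / \<epsilon>))"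
proof -
  define \<Lambda> where "\<Lambda> = ln (1 / \<gamma>d)"
  \<comment> \<open>Failures contribute slope \<open>\<Lambda>\<close> in \<open>k\<close>. Half of
    it pays for \<open>ln (1 + k)\<close> coming from \<open>M k\<close>, and the other half remains
    to bound \<open>k\<close>.\<close>
  define r where "r = \<Lambda> / 2"
  have \<Lambda>: "\<Lambda> > 0"
    using factors unfolding \<Lambda>_def by (intro ln_gt_zero) simp
  then have r: "r > 0" by (simp add: r_def)
  define C where "C = ln (\<Delta> 0) - ln \<delta> + ln m + (r - 1 - ln r)"
  \<comment> \<open>\<open>B\<close> dominates the coefficients of the constant term, of
    \<open>N k\<close> and of \<open>ln (1 / \<epsilon>)\<close> in the bound for
    \<open>r * k\<close>.\<close>
  define B where "B = max (max C (\<Lambda> + ln \<gamma>i)) 1"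
  have B: "C \<le> B" "\<Lambda> + ln \<gamma>i \<le> B" "1 \<le> B"
    by (simp_all add: B_def)
  define A where "A = max 1 (B / r)"
  have bound: "real k \<le> A * (N k + 1 + ln (1 / \<epsilon>))"
    if \<epsilon>: "0 < \<epsilon>" "\<epsilon> \<le> 1" and "\<forall>j<K. \<epsilon> \<le> \<sigma> j" "k \<le> K" for \<epsilon> K k
  proof -
    have l: "ln (1 / \<epsilon>) \<ge> 0"
      using \<epsilon> by simp
    have "\<delta> * \<epsilon> / M k \<le> \<Delta> k"
      by (rule radius_lower) fact+
    then have "ln (\<delta> * \<epsilon> / M k) \<le> ln (\<Delta> k)"
      using \<delta>_pos \<epsilon> M_pos[of k] radius_pos[of k] by simp
    moreover have "ln (\<delta> * \<epsilon> / M k) = ln \<delta> - ln (1 / \<epsilon>) - ln (M k)"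
      using \<delta>_pos \<epsilon> M_pos[of k] by (simp add: ln_div ln_mult)
    ultimately have 1: "ln \<delta> - ln (1 / \<epsilon>) - ln (M k) \<le> ln (\<Delta> 0) + N k * ln \<gamma>i - (real k - N k) * \<Lambda>"
      unfolding \<Lambda>_def using ln_radius[of k] by linarith
    have "ln (M k) \<le> ln (m * (1 + real k))"
      using M_le[of k] M_pos[of k] by (subst ln_le_cancel_iff) auto
    also have "\<dots> = ln m + ln (1 + real k)"
      using m_pos by (simp add: ln_mult)
    also have "\<dots> \<le> ln m + (r * k + (r - 1 - ln r))"
      using ln_1_plus_le_linear[of r "real k"] r by simp
    finally have "r * k \<le> C + N k * (\<Lambda> + ln \<gamma>i) + ln (1 / \<epsilon>)"
      using 1 by (simp add: r_def C_def algebra_simps)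
    also have "\<dots> \<le> B * (N k + 1 + ln (1 / \<epsilon>))"
    proof -
      have "N k * (\<Lambda> + ln \<gamma>i) \<le> N k * B"
        using B by (intro mult_left_mono) auto
      moreover have "1 * ln (1 / \<epsilon>) \<le> B * ln (1 / \<epsilon>)"
        using B l by (intro mult_right_mono) auto
      moreover have "B * (N k + 1 + ln (1 / \<epsilon>)) = B + N k * B + B * ln (1 / \<epsilon>)"
        by (simp add: distrib_left mult.commute)
      ultimately show ?thesis
        using B by linarith
    qed
    finally have "real k \<le> B / r * (N k + 1 + ln (1 / \<epsilon>))"
      using r by (simp add: field_simps)
    also have "\<dots> \<le> A * (N k + 1 + ln (1 / \<epsilon>))"
      using l by (intro mult_right_mono) (auto simp: A_def)
    finally show ?thesis .
  qed
  have "A \<ge> 1"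
    by (simp add: A_def)
  then show thesis
    by (rule that) (rule bound; assumption)
qed

text \<open>The decreases telescope once every \<open>M k\<close> is replaced by the largest one,
  \<open>M K\<close>.\<close>

lemma successes_bound:
  assumes "0 < \<epsilon>" "\<epsilon> \<le> 1" "\<forall>j<K. \<epsilon> \<le> \<sigma> j" "k \<le> K"
  shows "\<phi> k \<le> \<phi> 0 - N k * (a * min \<delta> 1 * \<epsilon>\<^sup>2 / M K)"
  using assms(4)
proof (induction k)
  case (Suc k)
  show ?case
  proof (cases "s k")
    case True
    have "M k \<le> M K"
      using M_mono Suc by (simp add: mono_def)
    then have "a * min \<delta> 1 * \<epsilon>\<^sup>2 / M K \<le> a * min \<delta> 1 * \<epsilon>\<^sup>2 / M k"
      using M_pos[of k] \<delta>_pos a_pos by (intro divide_left_mono) auto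
    moreover have "\<phi> (Suc k) \<le> \<phi> k - a * min \<delta> 1 * \<epsilon>\<^sup>2 / M k"
      using assms Suc True by (intro descent) auto
    moreover have "N (Suc k) * (a * min \<delta> 1 * \<epsilon>\<^sup>2 / M K)
        = N k * (a * min \<delta> 1 * \<epsilon>\<^sup>2 / M K) + a * min \<delta> 1 * \<epsilon>\<^sup>2 / M K"
      using True by (simp add: N_Suc algebra_simps add_divide_distrib)
    ultimately show ?thesis
      using Suc by linarith
  qed (use Suc in \<open>simp add: N_Suc stay\<close>)
qed simp

section \<open>Iteration bounds for sublinear and for linear growth of \<open>M\<close>\<close>

lemma index_bound_power:
  assumes t: "0 \<le> t" "t < 1" and M_powr: "\<And>k. k \<ge> 1 \<Longrightarrow> M k \<le> m * real k powr t"
  obtains C where "\<And>\<epsilon> K. \<lbrakk>0 < \<epsilon>; \<epsilon> \<le> 1; \<forall>j<K. \<epsilon> \<le> \<sigma> j\<rbrakk> \<Longrightarrow> real K \<le> C * \<epsilon> powr (- 2 / (1 - t))"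
proof -
  obtain A where A: "A \<ge> 1"
    "\<And>\<epsilon> K k. \<lbrakk>0 < \<epsilon>; \<epsilon> \<le> 1; \<forall>j<K. \<epsilon> \<le> \<sigma> j; k \<le> K\<rbrakk> \<Longrightarrow> real k \<le> A * (N k + 1 + ln (1 / \<epsilon>))"
    using index_le_successes by metis
  define c where "c = a * min \<delta> 1"
  have c: "c > 0"
    using a_pos \<delta>_pos by (simp add: c_def)
  define C where "C = (\<phi> 0 - low) * m / c"
  have C: "C \<ge> 0"
    using low[of 0] c m_pos by (simp add: C_def)
  have bound: "real K \<le> (A * (C + 2)) powr (1 / (1 - t)) * \<epsilon> powr (- 2 / (1 - t))"
    if \<epsilon>: "0 < \<epsilon>" "\<epsilon> \<le> 1" and K: "\<forall>j<K. \<epsilon> \<le> \<sigma> j" for \<epsilon> K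
  proof (cases "K = 0")
    case False
    then have K1: "K \<ge> 1" by simp
    \<comment> \<open>\<open>P\<close> bounds the successes up to the factor \<open>C\<close> and
      also dominates 1 and \<open>ln (1 / \<epsilon>)\<close>. The resulting inequality has
      \<open>K\<close> on both sides; dividing by \<open>K powr t\<close> leaves the exponent
      \<open>1 - t > 0\<close>, which is then inverted.\<close>
    define P where "P = 1 / \<epsilon>\<^sup>2 * real K powr t"
    have Kt: "real K powr t \<ge> 1"
      using K1 t by (simp add: ge_one_powr_ge_zero)
    have e1: "1 / \<epsilon> \<ge> 1"
      using \<epsilon> by simp
    then have e2: "1 / \<epsilon> \<le> 1 / \<epsilon>\<^sup>2"
      using self_le_power[of "1 / \<epsilon>" 2] by (simp add: power_divide)
    have "low \<le> \<phi> 0 - N K * (c * \<epsilon>\<^sup>2 / M K)"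
      using successes_bound[OF \<epsilon> K, of K] low[of K] by (simp add: c_def)
    then have "N K * (c * \<epsilon>\<^sup>2) \<le> (\<phi> 0 - low) * M K"
      using M_pos[of K] by (simp add: field_simps)
    also have "\<dots> \<le> (\<phi> 0 - low) * (m * real K powr t)"
      using low[of 0] M_powr[OF K1] by (intro mult_left_mono) auto
    finally have N: "N K \<le> C * P"
      using c \<epsilon> by (simp add: C_def P_def field_simps)
    have "1 / \<epsilon>\<^sup>2 * 1 \<le> P"
      unfolding P_def using Kt by (intro mult_left_mono) auto
    moreover have "ln (1 / \<epsilon>) \<le> 1 / \<epsilon>"
      using ln_le_minus_one[of "1 / \<epsilon>"] \<epsilon> by simp
    ultimately have "N K + 1 + ln (1 / \<epsilon>) \<le> C * P + 2 * P"
      using N e1 e2 by linarith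
    then have "A * (N K + 1 + ln (1 / \<epsilon>)) \<le> A * ((C + 2) * P)"
      using A(1) by (intro mult_left_mono) (auto simp: distrib_right)
    with A(2)[OF \<epsilon> K, of K] have "real K \<le> A * ((C + 2) * P)"
      by linarith
    also have "\<dots> = (A * (C + 2)) * (1 / \<epsilon>\<^sup>2) * real K powr t"
      by (simp add: P_def)
    finally have "real K \<le> (A * (C + 2)) * (1 / \<epsilon>\<^sup>2) * real K powr t" .
    moreover have "real K = real K powr (1 - t) * real K powr t"
      using K1 by (simp flip: powr_add)
    ultimately have "real K powr (1 - t) * real K powr t \<le> (A * (C + 2)) * (1 / \<epsilon>\<^sup>2) * real K powr t"
      by linarith
    then have "real K powr (1 - t) \<le> (A * (C + 2)) * (1 / \<epsilon>\<^sup>2)"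
      using Kt by (subst (asm) mult_le_cancel_right_pos) (use K1 in auto)
    then have "real K powr (1 - t) \<le> (A * (C + 2)) * \<epsilon> powr (- 2)"
      using \<epsilon> by (simp add: powr_minus_divide)
    then have "(real K powr (1 - t)) powr (1 / (1 - t)) \<le> ((A * (C + 2)) * \<epsilon> powr (- 2)) powr (1 / (1 - t))"
      using t by (intro powr_mono2) auto
    then show ?thesis
      using t A(1) C \<epsilon> K1 by (simp add: powr_powr powr_mult)
  qed (use \<epsilon> in simp)
  show thesis
    by (rule that) (rule bound; assumption)
qed

lemma index_bound_exp:
  obtains c C where "c > 0"
    "\<And>\<epsilon> K. \<lbrakk>0 < \<epsilon>; \<epsilon> \<le> 1; \<forall>j<K. \<epsilon> \<le> \<sigma> j\<rbrakk> \<Longrightarrow> real K \<le> C * (2 + ln (1 / \<epsilon>)) * exp (c * \<epsilon> powr (- 2))"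
proof -
  obtain A where A: "A \<ge> 1"
    "\<And>\<epsilon> K k. \<lbrakk>0 < \<epsilon>; \<epsilon> \<le> 1; \<forall>j<K. \<epsilon> \<le> \<sigma> j; k \<le> K\<rbrakk> \<Longrightarrow> real k \<le> A * (N k + 1 + ln (1 / \<epsilon>))"
    using index_le_successes by metis
  define b where "b = a * min \<delta> 1"
  have b: "b > 0"
    using a_pos \<delta>_pos by (simp add: b_def)
  define d where "d = b / (m * A)"
  have d: "d > 0"
    using b m_pos A(1) by (simp add: d_def)
  \<comment> \<open>The added 1 keeps \<open>c\<close> positive even if the initial value already
    equals the lower bound.\<close>
  define c where "c = (\<phi> 0 - low) / d + 1"
  have "0 \<le> (\<phi> 0 - low) / d"
    using low[of 0] d by simp
  then have c: "c > 0" by (simp add: c_def)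
  have bound: "real K \<le> A * (2 + ln (1 / \<epsilon>)) * exp (c * \<epsilon> powr (- 2))"
    if \<epsilon>: "0 < \<epsilon>" "\<epsilon> \<le> 1" and K: "\<forall>j<K. \<epsilon> \<le> \<sigma> j" for \<epsilon> K
  proof -
    define l where "l = ln (1 / \<epsilon>)"
    have l: "l \<ge> 0"
      using \<epsilon> by (simp add: l_def)
    \<comment> \<open>A success decreases the objective by at least
      \<open>d * \<epsilon>\<^sup>2 / n\<close> with \<open>n = N k + 2 + l\<close>. Since
      \<open>1 / n\<close> is at least \<open>ln (n + 1) - ln n\<close>, the harmonic sum becomes a
      telescoping logarithm. The 2 in \<open>n\<close> makes room for the 1 in
      \<open>1 + real k\<close>, as \<open>A \<ge> 1\<close>.\<close>
    have log_descent: "\<phi> k \<le> \<phi> 0 - d * \<epsilon>\<^sup>2 * (ln (N k + 2 + l) - ln (2 + l))" if "k \<le> K" for k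
      using that
    proof (induction k)
      case (Suc k)
      show ?case
      proof (cases "s k")
        case True
        let ?n = "N k + 2 + l"
        have n: "?n > 0"
          using l by simp
        have "1 + real k \<le> 1 + A * (N k + 1 + l)"
          using A(2)[OF \<epsilon> K, of k] Suc by (simp add: l_def)
        also have "\<dots> \<le> A * ?n"
          using A(1) by (simp add: algebra_simps)
        finally have "m * (1 + real k) \<le> m * (A * ?n)"
          using m_pos by simp
        with M_le[of k] have "M k \<le> m * A * ?n"
          by simp
        then have "b * \<epsilon>\<^sup>2 / (m * A * ?n) \<le> b * \<epsilon>\<^sup>2 / M k"
          using M_pos[of k] b n m_pos A(1) by (intro divide_left_mono) auto
        then have 1: "d * \<epsilon>\<^sup>2 * (1 / ?n) \<le> b * \<epsilon>\<^sup>2 / M k"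
          by (simp add: d_def)
        have "ln (1 + 1 / ?n) \<le> 1 / ?n"
          using n by (intro ln_add_one_self_le_self) simp
        moreover have "1 + 1 / ?n = (?n + 1) / ?n"
          using n by (simp add: field_simps)
        ultimately have "ln (?n + 1) - ln ?n \<le> 1 / ?n"
          using n by (simp add: ln_div)
        then have "d * \<epsilon>\<^sup>2 * (ln (?n + 1) - ln ?n) \<le> d * \<epsilon>\<^sup>2 * (1 / ?n)"
          using d by (intro mult_left_mono) auto
        moreover have "N (Suc k) + 2 + l = ?n + 1"
          using True by (simp add: N_Suc)
        ultimately show ?thesis
          using 1 descent[OF \<epsilon> K, of k] True Suc by (simp add: b_def algebra_simps)
      qed (use Suc in \<open>simp add: N_Suc stay\<close>)
    qed simp
    have "d * \<epsilon>\<^sup>2 * (ln (N K + 2 + l) - ln (2 + l)) \<le> \<phi> 0 - low"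
      using log_descent[of K] low[of K] by simp
    then have "ln (N K + 2 + l) - ln (2 + l) \<le> (\<phi> 0 - low) / d * (1 / \<epsilon>\<^sup>2)"
      using d \<epsilon> by (simp add: field_simps)
    also have "\<dots> \<le> c * (1 / \<epsilon>\<^sup>2)"
      by (intro mult_right_mono) (auto simp: c_def)
    also have "\<dots> = c * \<epsilon> powr (- 2)"
      using \<epsilon> by (simp add: powr_minus_divide)
    finally have "ln (N K + 2 + l) \<le> ln (2 + l) + c * \<epsilon> powr (- 2)"
      by simp
    then have "exp (ln (N K + 2 + l)) \<le> exp (ln (2 + l) + c * \<epsilon> powr (- 2))"
      by simp
    then have "N K + 2 + l \<le> (2 + l) * exp (c * \<epsilon> powr (- 2))"
      using l by (simp add: exp_add)
    then have "N K + 1 + l \<le> (2 + l) * exp (c * \<epsilon> powr (- 2))"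
      by simp
    then have "A * (N K + 1 + l) \<le> A * ((2 + l) * exp (c * \<epsilon> powr (- 2)))"
      using A(1) by (intro mult_left_mono) auto
    then show ?thesis
      using A(2)[OF \<epsilon> K, of K] by (simp add: l_def mult.assoc)
  qed
  show thesis
    by (rule that[OF c]) (rule bound; assumption)
qed

end

section \<open>Gradient, Taylor error and Hessian term\<close>

lemma GDERIV_grad:
  fixes f :: "'a::euclidean_space \<Rightarrow> real"
  assumes "f differentiable (at x)"
  shows "GDERIV f x :> grad f x"
proof -
  obtain f' where f': "(f has_derivative f') (at x)"
    using assms by (auto simp: differentiable_def)
  then interpret bounded_linear f'
    by (rule has_derivative_bounded_linear)
  \<comment> \<open>\<open>adjoint f' 1\<close> is the Riesz representative of the functional
    \<open>f'\<close>. Its uniqueness is what the definite description in \<open>grad\<close>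
    requires.\<close>
  have "f' = (\<lambda>v. v \<bullet> adjoint f' 1)"
    using adjoint_works[OF linear_axioms] by fastforce
  with f' have D: "GDERIV f x :> adjoint f' 1"
    by (metis gderiv_def)
  moreover have "D = adjoint f' 1" if "GDERIV f x :> D" for D
  proof -
    have "(\<lambda>v. v \<bullet> D) = (\<lambda>v. v \<bullet> adjoint f' 1)"
      using that D unfolding gderiv_def by (rule has_derivative_unique)
    then show ?thesis
      by (metis vector_eq_ldot)
  qed
  ultimately show ?thesis
    unfolding grad_def by (rule theI)
qed

text \<open>The mean value theorem on the segment from \<open>x\<close> to \<open>x + p\<close>
  yields one intermediate gradient, which differs from the initial one by at most
  \<open>L * norm p\<close>. The sharp factor 1/2 is given up, which affects only constants.\<close>

lemma taylor_error_le:
  fixes f :: "'a::euclidean_space \<Rightarrow> real"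
  assumes diff: "\<forall>y. f differentiable (at y)" and lip: "L-lipschitz_on UNIV (grad f)"
  shows "f (x + p) - f x - grad f x \<bullet> p \<le> L * (norm p)\<^sup>2"
proof -
  let ?g = "\<lambda>u. f (x + u *\<^sub>R p)"
  have "(?g has_real_derivative grad f (x + u *\<^sub>R p) \<bullet> p) (at u)" for u
  proof -
    have "(f has_derivative (\<lambda>v. v \<bullet> grad f (x + u *\<^sub>R p))) (at (x + u *\<^sub>R p))"
      using GDERIV_grad diff by (auto simp: gderiv_def)
    then have "(?g has_derivative (\<lambda>v. (v *\<^sub>R p) \<bullet> grad f (x + u *\<^sub>R p))) (at u)"
      by (rule has_derivative_compose[rotated]) (auto intro!: derivative_eq_intros)
    then show ?thesis
      by (simp add: has_field_derivative_def inner_commute mult_commute_abs)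
  qed
  then obtain u where u: "0 < u" "u < 1" "?g 1 - ?g 0 = (1 - 0) * (grad f (x + u *\<^sub>R p) \<bullet> p)"
    using MVT2[of 0 1 ?g "\<lambda>u. grad f (x + u *\<^sub>R p) \<bullet> p"] by auto
  then have "f (x + p) - f x - grad f x \<bullet> p = (grad f (x + u *\<^sub>R p) - grad f x) \<bullet> p"
    by (simp add: inner_diff_left)
  also have "\<dots> \<le> norm (grad f (x + u *\<^sub>R p) - grad f x) * norm p"
    by (rule norm_cauchy_schwarz)
  also have "\<dots> \<le> (L * norm (u *\<^sub>R p)) * norm p"
    using lipschitz_onD[OF lip, of "x + u *\<^sub>R p" x]
    by (intro mult_right_mono) (auto simp: dist_norm)
  also have "\<dots> \<le> (L * norm p) * norm p"
    using u lipschitz_on_nonneg[OF lip]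
    by (intro mult_right_mono mult_left_mono) (auto intro: mult_left_le_one_le)
  finally show ?thesis
    by (simp add: power2_eq_square mult_ac)
qed

lemma norm2_nonneg: "norm2 A \<ge> 0"
  unfolding norm2_def by (rule onorm_pos_le[OF matrix_vector_mul_bounded_linear])

lemma inner_matrix_le_norm2:
  fixes A :: "real^'d^'d"
  shows "\<bar>v \<bullet> (A *v v)\<bar> \<le> norm2 A * (norm v)\<^sup>2"
proof -
  have "\<bar>v \<bullet> (A *v v)\<bar> \<le> norm v * norm (A *v v)"
    by (rule Cauchy_Schwarz_ineq2)
  also have "\<dots> \<le> norm v * (norm2 A * norm v)"
    unfolding norm2_def
    by (intro mult_left_mono onorm[OF matrix_vector_mul_bounded_linear]) auto
  finally show ?thesis
    by (simp add: power2_eq_square mult_ac)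
qed

section \<open>Finiteness of trial points, the first index and powers of the index\<close>

lemma stationarity_nonneg: "\<gamma> > 0 \<Longrightarrow> stationarity f h x \<gamma> \<ge> 0"
  by (simp add: stationarity_def)

text \<open>If \<open>h (x + p)\<close> were infinite, the model decrease would be minus infinity
  and could not exceed a real number.\<close>

lemma model_decrease_finite:
  assumes "proper h" "h x \<noteq> \<infinity>" "ereal r \<le> model f h x H 0 - model f h x H p"
  shows "h (x + p) \<noteq> \<infinity>"
  using assms by (cases "h x") (auto simp: proper_def model_def)

text \<open>The bound holds for every \<open>K\<close> before which the measure stays at least
  \<epsilon>. If the measure never fell below \<epsilon>, arbitrarily large \<open>K\<close> would
  qualify, so the first index is finite; it is then itself such a \<open>K\<close>.\<close>

lemma first_index_bigo:
  assumes "g \<in> O[at_right 0](g')" "\<epsilon>0 > 0"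
    and bound: "\<And>\<epsilon> K. \<lbrakk>0 < \<epsilon>; \<epsilon> \<le> \<epsilon>0; \<forall>j<K. \<epsilon> \<le> stationarity f h (x j) \<gamma>\<rbrakk> \<Longrightarrow> real K \<le> g \<epsilon>"
  shows "enat_bigo (first_index f h x \<gamma>) g'"
proof -
  have ev: "\<forall>\<^sub>F \<epsilon> in at_right 0. 0 < \<epsilon> \<and> \<epsilon> \<le> \<epsilon>0"
    using eventually_at_right_real[OF \<open>\<epsilon>0 > 0\<close>] by eventually_elim auto
  have fin: "\<exists>k. stationarity f h (x k) \<gamma> < \<epsilon>" if "0 < \<epsilon>" "\<epsilon> \<le> \<epsilon>0" for \<epsilon>
  proof (rule ccontr)
    assume "\<nexists>k. stationarity f h (x k) \<gamma> < \<epsilon>"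
    then have "real K \<le> g \<epsilon>" for K
      using bound[OF that, of K] by (simp add: not_less)
    then show False
      by (meson linorder_not_le reals_Archimedean2)
  qed
  have le: "real (the_enat (first_index f h x \<gamma> \<epsilon>)) \<le> g \<epsilon>" if "0 < \<epsilon>" "\<epsilon> \<le> \<epsilon>0" for \<epsilon>
  proof -
    have "\<epsilon> \<le> stationarity f h (x j) \<gamma>" if "j < (LEAST k. stationarity f h (x k) \<gamma> < \<epsilon>)" for j
      using not_less_Least[OF that] by simp
    then show ?thesis
      using fin[OF that] bound[OF that] by (simp add: first_index_def)
  qed
  have "(\<lambda>\<epsilon>. real (the_enat (first_index f h x \<gamma> \<epsilon>))) \<in> O[at_right 0](g)"
    by (rule bigoI[of _ 1], use ev in eventually_elim) (use le in force)
  moreover have "\<forall>\<^sub>F \<epsilon> in at_right 0. first_index f h x \<gamma> \<epsilon> \<noteq> \<infinity>"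
    using ev by eventually_elim (use fin in \<open>simp add: first_index_def\<close>)
  ultimately show ?thesis
    using assms(1) unfolding enat_bigo_def by (blast intro: landau_o.big_trans)
qed

lemma nat_rpow_mono: "0 \<le> t \<Longrightarrow> i \<le> j \<Longrightarrow> nat_rpow i t \<le> nat_rpow j t"
  by (simp add: nat_rpow_def powr_mono2)

lemma nat_rpow_eq_powr: "k \<ge> 1 \<Longrightarrow> nat_rpow k t = real k powr t"
  by (simp add: nat_rpow_def)

text \<open>The summand 1 covers \<open>nat_rpow 0 0 = 1\<close>.\<close>

lemma nat_rpow_le:
  assumes "0 \<le> t" "t \<le> 1"
  shows "nat_rpow k t \<le> 1 + real k"
proof (cases "k = 0")
  case False
  then have "real k powr t \<le> real k powr 1"
    using assms by (intro powr_mono) auto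
  then show ?thesis
    by (auto simp: nat_rpow_def)
qed (simp add: nat_rpow_def)

section \<open>The trust-region run as an instance of the scalar recursion\<close>

theorem corollary3p15:
  fixes f :: "real^'d \<Rightarrow> real" and h :: "real^'d \<Rightarrow> ereal"
    and L F_low \<gamma>dec \<gamma>inc \<eta> \<mu> t \<kappa>p \<gamma>max :: real
    and x p :: "nat \<Rightarrow> real^'d" and \<Delta> :: "nat \<Rightarrow> real" and H :: "nat \<Rightarrow> real^'d^'d"
  assumes "\<forall>y. f differentiable (at y)"
    and "L-lipschitz_on UNIV (grad f)"
    and "proper h" and "lower_semicontinuous h" and "convex_ereal h"
    and "\<forall>y. ereal F_low \<le> objective f h y"
    and "0 < \<gamma>dec" and "\<gamma>dec < 1" and "1 < \<gamma>inc" and "0 < \<eta>" and "\<eta> < 1"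
    and "trust_region_run f h \<gamma>dec \<gamma>inc \<eta> x \<Delta> H p"
    and "\<mu> > 0" and "0 \<le> t" and "t \<le> 1"
    and "\<forall>k. Max ((\<lambda>j. norm2 (H j)) ` {0..k}) \<le> \<mu> * (1 + nat_rpow k t)"
    and "\<kappa>p > 0" and "\<gamma>max > 0"
    and "\<forall>k. model f h (x k) (H k) 0 - model f h (x k) (H k) (p k)
           \<ge> ereal (\<kappa>p * stationarity f h (x k) \<gamma>max *
                min (\<Delta> k) (stationarity f h (x k) \<gamma>max / (1 + norm2 (H k))))"
  shows "(t < 1 \<longrightarrow> enat_bigo (first_index f h x \<gamma>max) (\<lambda>\<epsilon>. \<epsilon> powr (- 2 / (1 - t)))) \<and>
         (t = 1 \<longrightarrow> (\<exists>c>0. enat_soft_bigo (first_index f h x \<gamma>max) (\<lambda>\<epsilon>. exp (c * \<epsilon> powr (- 2)))))"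
proof -
  note diff = assms(1) and lip = assms(2) and h_proper = assms(3) and lower = assms(6)
    and run = assms(12) and t = assms(14,15) and decrease = assms(19)
  define \<sigma> where "\<sigma> k = stationarity f h (x k) \<gamma>max" for k
  define s where "s k \<longleftrightarrow> ratio f h (x k) (H k) (p k) \<ge> ereal \<eta>" for k
  define u where "u k = real_of_ereal (h (x k))" for k
  define v where "v k = real_of_ereal (h (x k + p k))" for k
  define \<phi> where "\<phi> k = f (x k) + u k" for k
  define M where "M k = 1 + \<mu> * (1 + nat_rpow k t)" for k
  \<comment> \<open>\<open>q\<close> is the actual and \<open>D\<close> the predicted decrease, as
    real numbers: the numerator and denominator of the ratio.\<close>
  define q where "q k = f (x k) - f (x k + p k) + u k - v k" for k
  define D where "D k = u k - v k - grad f (x k) \<bullet> p k - 1 / 2 * (p k \<bullet> (H k *v p k))" for k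
  have step: "x (Suc k) = (if s k then x k + p k else x k)"
      "\<Delta> (Suc k) = (if s k then \<gamma>inc else \<gamma>dec) * \<Delta> k" and p_le: "norm (p k) \<le> \<Delta> k" for k
    using run by (auto simp: trust_region_run_def s_def)
  have radius_0: "\<Delta> 0 > 0"
    using run by (simp add: trust_region_run_def)
  have L: "L \<ge> 0"
    using lip by (rule lipschitz_on_nonneg)
  \<comment> \<open>The next iterate is the current one or the trial point, and sufficient decrease
    makes \<open>h\<close> finite at the latter.\<close>
  have hfin: "h (x k) \<noteq> \<infinity>" for k
  proof (induction k)
    case 0
    then show ?case
      using run by (auto simp: trust_region_run_def effective_domain_def objective_def)
  next
    case (Suc k)
    then show ?case
      using model_decrease_finite[OF h_proper Suc] decrease by (simp add: step) metis
  qed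
  have hpfin: "h (x k + p k) \<noteq> \<infinity>" for k
    using model_decrease_finite[OF h_proper hfin] decrease by blast
  have h_real: "h (x k) = ereal (u k)" "h (x k + p k) = ereal (v k)" for k
    using hfin[of k] hpfin[of k] h_proper
    by (auto simp: u_def v_def proper_def intro!: ereal_real'[symmetric])
  have \<phi>: "objective f h (x k) = ereal (\<phi> k)" for k
    by (simp add: \<phi>_def objective_def h_real)
  have obj_diff: "objective f h (x k) - objective f h (x k + p k) = ereal (q k)" for k
    by (simp add: q_def objective_def h_real)
  have model_diff: "model f h (x k) (H k) 0 - model f h (x k) (H k) (p k) = ereal (D k)" for k
    by (simp add: D_def model_def h_real)
  have norm2_le: "1 + norm2 (H k) \<le> M k" for k
  proof -
    have "norm2 (H k) \<le> Max ((\<lambda>j. norm2 (H j)) ` {0..k})"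
      by (intro Max_ge) auto
    then show ?thesis
      using assms(16) by (fastforce simp: M_def)
  qed
  have \<sigma>_nonneg: "\<sigma> k \<ge> 0" for k
    using stationarity_nonneg assms(18) by (simp add: \<sigma>_def)
  have M1: "M k \<ge> 1" for k
    using norm2_le[of k] norm2_nonneg[of "H k"] by linarith
  have radius_pos: "\<Delta> k > 0" for k
    using radius_0 assms(7-9) by (induction k) (simp_all add: step)
  have D_ge: "\<kappa>p * (\<sigma> k * min (\<Delta> k) (\<sigma> k / M k)) \<le> D k" for k
  proof -
    have "\<sigma> k / M k \<le> \<sigma> k / (1 + norm2 (H k))"
      using norm2_le[of k] norm2_nonneg[of "H k"] M1[of k] \<sigma>_nonneg[of k]
      by (intro divide_left_mono) auto
    then have "\<kappa>p * (\<sigma> k * min (\<Delta> k) (\<sigma> k / M k)) \<le> \<kappa>p * (\<sigma> k * min (\<Delta> k) (\<sigma> k / (1 + norm2 (H k))))"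
      using \<sigma>_nonneg[of k] assms(17) by (intro mult_left_mono min.mono) auto
    then show ?thesis
      using decrease[rule_format, of k] unfolding model_diff by (simp add: \<sigma>_def mult_ac)
  qed
  have D_pos: "D k > 0" if "\<sigma> k > 0" for k
  proof -
    have "0 < \<kappa>p * (\<sigma> k * min (\<Delta> k) (\<sigma> k / M k))"
      using that radius_pos[of k] assms(17) M1[of k] by simp
    then show ?thesis
      using D_ge[of k] by linarith
  qed
  \<comment> \<open>Positivity of \<open>D k\<close> excludes the conventional value of a quotient
    with zero denominator.\<close>
  have s_iff: "s k \<longleftrightarrow> \<eta> * D k \<le> q k" if "\<sigma> k > 0" for k
    using D_pos[OF that] unfolding s_def ratio_def obj_diff model_diff
    by (simp add: pos_le_divide_eq)
  \<comment> \<open>The values of \<open>h\<close> cancel in this difference, leaving the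
    first-order Taylor error of \<open>f\<close> and the quadratic term.\<close>
  have error: "D k - q k \<le> (L + 1) * M k * (\<Delta> k)\<^sup>2" for k
  proof -
    have "D k - q k = f (x k + p k) - f (x k) - grad f (x k) \<bullet> p k - 1 / 2 * (p k \<bullet> (H k *v p k))"
      by (simp add: D_def q_def)
    also have "\<dots> \<le> L * (norm (p k))\<^sup>2 + norm2 (H k) * (norm (p k))\<^sup>2"
      using taylor_error_le[OF diff lip, of "x k" "p k"] inner_matrix_le_norm2[of "p k" "H k"] by linarith
    also have "\<dots> = (L + norm2 (H k)) * (norm (p k))\<^sup>2"
      by (simp add: algebra_simps)
    also have "\<dots> \<le> ((L + 1) * M k) * (\<Delta> k)\<^sup>2"
    proof (intro mult_mono power_mono p_le)
      have "L * 1 \<le> L * M k"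
        using L M1[of k] by (intro mult_left_mono) auto
      then show "L + norm2 (H k) \<le> (L + 1) * M k"
        using norm2_le[of k] by (simp add: algebra_simps)
    qed (use L M1[of k] in auto)
    finally show ?thesis .
  qed
  \<comment> \<open>A success realises the fraction \<open>\<eta>\<close> of the predicted decrease.
    After a failure \<open>D k - q k\<close> exceeds \<open>(1 - \<eta>) * D k\<close>, and
    comparison with \<open>error\<close> gives the second constant.\<close>
  interpret radius_descent \<phi> \<Delta> \<sigma> M s F_low \<gamma>dec \<gamma>inc "\<eta> * \<kappa>p" "(1 - \<eta>) * \<kappa>p / (L + 1)" "1 + 2 * \<mu>"
  proof
    fix k
    show "F_low \<le> \<phi> k"
      using lower[rule_format, of "x k"] by (simp add: \<phi>)
    show "\<phi> (Suc k) \<le> \<phi> k - \<eta> * \<kappa>p * (\<sigma> k * min (\<Delta> k) (\<sigma> k / M k))" if "s k" "\<sigma> k > 0"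
    proof -
      have "\<phi> (Suc k) = \<phi> k - q k"
        using obj_diff[of k] \<phi>[of k] \<phi>[of "Suc k"] that by (simp add: step)
      moreover have "\<eta> * (\<kappa>p * (\<sigma> k * min (\<Delta> k) (\<sigma> k / M k))) \<le> \<eta> * D k"
        using D_ge[of k] assms(10) by simp
      ultimately show ?thesis
        using s_iff[of k] that by (simp add: mult.assoc)
    qed
    show "(1 - \<eta>) * \<kappa>p / (L + 1) * (\<sigma> k * min (\<Delta> k) (\<sigma> k / M k)) \<le> M k * (\<Delta> k)\<^sup>2"
      if "\<not> s k" "\<sigma> k > 0"
    proof -
      have "(1 - \<eta>) * (\<kappa>p * (\<sigma> k * min (\<Delta> k) (\<sigma> k / M k))) \<le> (1 - \<eta>) * D k"
        using D_ge[of k] assms(11) by simp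
      also have "\<dots> \<le> D k - q k"
        using s_iff[of k] that by (simp add: algebra_simps)
      also note error[of k]
      finally show ?thesis
        using L by (simp add: field_simps)
    qed
    show "\<phi> (Suc k) = \<phi> k" if "\<not> s k"
      using that by (simp add: \<phi>_def u_def step)
    have "nat_rpow i t \<le> nat_rpow j t" if "i \<le> j" for i j
      using that t by (intro nat_rpow_mono)
    then show "mono M"
      using assms(13) by (auto simp: mono_def M_def)
    have "\<mu> * nat_rpow k t \<le> \<mu> * (1 + real k)"
      using nat_rpow_le[OF t, of k] assms(13) by simp
    moreover have "0 \<le> \<mu> * real k"
      using assms(13) by simp
    ultimately show "M k \<le> (1 + 2 * \<mu>) * (1 + real k)"
      unfolding M_def distrib_left distrib_right by simp
  qed (use radius_0 step assms(7-11,17) L M1 in auto)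
  show ?thesis
  proof (intro conjI impI)
    assume "t < 1"
    have "M k \<le> (1 + 2 * \<mu>) * real k powr t" if "k \<ge> 1" for k
    proof -
      \<comment> \<open>This lets the power absorb the constant \<open>1 + \<mu>\<close> in
        \<open>M k\<close>.\<close>
      have "real k powr t \<ge> 1"
        using that t by (simp add: ge_one_powr_ge_zero)
      then have "(1 + \<mu>) * 1 \<le> (1 + \<mu>) * real k powr t"
        using assms(13) by (intro mult_left_mono) auto
      then show ?thesis
        using that by (simp add: M_def nat_rpow_eq_powr algebra_simps)
    qed
    from index_bound_power[OF t(1) \<open>t < 1\<close> this] obtain C where
      "\<And>\<epsilon> K. \<lbrakk>0 < \<epsilon>; \<epsilon> \<le> 1; \<forall>j<K. \<epsilon> \<le> \<sigma> j\<rbrakk> \<Longrightarrow> real K \<le> C * \<epsilon> powr (- 2 / (1 - t))"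
      by blast
    then show "enat_bigo (first_index f h x \<gamma>max) (\<lambda>\<epsilon>. \<epsilon> powr (- 2 / (1 - t)))"
      unfolding \<sigma>_def
      by (intro first_index_bigo[of "\<lambda>\<epsilon>. C * \<epsilon> powr (- 2 / (1 - t))" _ 1]) auto
  next
    obtain c C where c: "c > 0" and
      bound: "\<And>\<epsilon> K. \<lbrakk>0 < \<epsilon>; \<epsilon> \<le> 1; \<forall>j<K. \<epsilon> \<le> \<sigma> j\<rbrakk> \<Longrightarrow>
        real K \<le> C * (2 + ln (1 / \<epsilon>)) * exp (c * \<epsilon> powr (- 2))"
      using index_bound_exp by blast
    let ?g = "\<lambda>\<epsilon>. C * (2 + ln (1 / \<epsilon>)) * exp (c * \<epsilon> powr (- 2))"
    \<comment> \<open>Below \<open>exp (- 1)\<close> the logarithm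
      \<open>ln (1 / \<epsilon>)\<close> is at least 1, so \<open>2 + ln (1 / \<epsilon>)\<close> is
      at most three times it and one logarithmic factor suffices.\<close>
    have "\<forall>\<^sub>F \<epsilon> in at_right 0. 0 < \<epsilon> \<and> \<epsilon> < exp (- 1 :: real)"
      using eventually_at_right_real[of 0 "exp (- 1 :: real)"] by (simp add: greaterThanLessThan_def)
    then have "?g \<in> O[at_right 0](\<lambda>\<epsilon>. exp (c * \<epsilon> powr (- 2)) * ln (1 / \<epsilon>) ^ 1)"
    proof (intro bigoI[of _ "3 * \<bar>C\<bar>"], eventually_elim)
      case (elim \<epsilon>)
      then have "ln \<epsilon> < ln (exp (- 1))"
        by (subst ln_less_cancel_iff) auto
      then have l: "ln (1 / \<epsilon>) \<ge> 1"
        using elim by (simp add: ln_div)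
      then have "\<bar>2 + ln (1 / \<epsilon>)\<bar> \<le> 3 * \<bar>ln (1 / \<epsilon>)\<bar>"
        by linarith
      then have "\<bar>C\<bar> * \<bar>2 + ln (1 / \<epsilon>)\<bar> * exp (c * \<epsilon> powr (- 2))
          \<le> \<bar>C\<bar> * (3 * \<bar>ln (1 / \<epsilon>)\<bar>) * exp (c * \<epsilon> powr (- 2))"
        by (intro mult_right_mono mult_left_mono) auto
      then show ?case
        by (simp add: abs_mult mult_ac)
    qed
    then have "enat_bigo (first_index f h x \<gamma>max) (\<lambda>\<epsilon>. exp (c * \<epsilon> powr (- 2)) * ln (1 / \<epsilon>) ^ 1)"
      by (rule first_index_bigo[of _ _ 1]) (use bound in \<open>auto simp: \<sigma>_def\<close>)
    with c show "\<exists>c>0. enat_soft_bigo (first_index f h x \<gamma>max) (\<lambda>\<epsilon>. exp (c * \<epsilon> powr (- 2)))"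
      unfolding enat_soft_bigo_def by blast
  qed
qed

end
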